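(* Let $a\ge 0$ and let $r>0$, $p>0$ and $q$ be continuous real functions on $[a,\infty)$. If $\int^\infty \frac{1}{r(t)}\,dt=+\infty$ and $\int^\infty q(t)\,dt=-\infty$, then the equation $(r(x)y'')''-(q(x)y')'=p(x)y$ is systems-conjugate in $(a,\infty)$.
   Context: For a function $y$ put $y_1=ry''$ and $Ty=(ry'')'-qy'$. A solution of $(ry'')''-(qy')'=py$ is a function $y$ such that $y,y',y_1,Ty$ are continuously differentiable and $(Ty)'=py$. The systems-conjugate point $\hat\eta_1(a)$ is the smallest $b\in(a,\infty)$ for which there is a nontrivial solution with $y(a)=y_1(a)=y(b)=y_1(b)=0$. The equation is systems-conjugate in $(a,\infty)$ if $\hat\eta_1(a)$ exists (i.e. such a $b$ exists). $\int^\infty f=\pm\infty$ means $\lim_{x\to\infty}\int_a^x f(t)\,dt=\pm\infty$. *)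

theory Defs
  imports "HOL-Analysis.Analysis"
begin

text \<open>
  Functions on the half-line $[a,\infty)$ are represented by total functions on the reals whose
  values to the left of \<open>a\<close> are irrelevant: all derivatives are taken within \<open>{a..}\<close>, so they
  are one-sided at \<open>a\<close>.
\<close>

definition hderiv :: "real \<Rightarrow> (real \<Rightarrow> real) \<Rightarrow> real \<Rightarrow> real" where
  "hderiv a f x = vector_derivative f (at x within {a..})"

definition C1_halfline :: "real \<Rightarrow> (real \<Rightarrow> real) \<Rightarrow> bool" where
  "C1_halfline a f \<longleftrightarrow> f differentiable_on {a..} \<and> continuous_on {a..} (hderiv a f)"

definition quasi1 :: "real \<Rightarrow> (real \<Rightarrow> real) \<Rightarrow> (real \<Rightarrow> real) \<Rightarrow> real \<Rightarrow> real" where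
  "quasi1 a r y x = r x * hderiv a (hderiv a y) x"

definition quasiT ::
  "real \<Rightarrow> (real \<Rightarrow> real) \<Rightarrow> (real \<Rightarrow> real) \<Rightarrow> (real \<Rightarrow> real) \<Rightarrow> real \<Rightarrow> real" where
  "quasiT a r q y x = hderiv a (quasi1 a r y) x - q x * hderiv a y x"

text \<open>
  Solutions of $(ry'')'' - (qy')' = py$ on $[a,\infty)$. As \<open>r\<close> and \<open>q\<close> are merely continuous, the
  equation is understood through the quasi-derivatives $y_1 = ry''$ and $Ty = (ry'')' - qy'$.
\<close>

definition is_solution ::
  "real \<Rightarrow> (real \<Rightarrow> real) \<Rightarrow> (real \<Rightarrow> real) \<Rightarrow> (real \<Rightarrow> real) \<Rightarrow> (real \<Rightarrow> real) \<Rightarrow> bool" where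
  "is_solution a r q p y \<longleftrightarrow>
     C1_halfline a y \<and> C1_halfline a (hderiv a y) \<and>
     C1_halfline a (quasi1 a r y) \<and> C1_halfline a (quasiT a r q y) \<and>
     (\<forall>x\<ge>a. hderiv a (quasiT a r q y) x = p x * y x)"

definition systems_conjugate_points ::
  "real \<Rightarrow> (real \<Rightarrow> real) \<Rightarrow> (real \<Rightarrow> real) \<Rightarrow> (real \<Rightarrow> real) \<Rightarrow> real set" where
  "systems_conjugate_points a r q p =
     {b. a < b \<and>
         (\<exists>y. is_solution a r q p y \<and> (\<exists>x\<ge>a. y x \<noteq> 0) \<and>
              y a = 0 \<and> quasi1 a r y a = 0 \<and> y b = 0 \<and> quasi1 a r y b = 0)}"

definition is_first_systems_conjugate_point ::
  "real \<Rightarrow> (real \<Rightarrow> real) \<Rightarrow> (real \<Rightarrow> real) \<Rightarrow> (real \<Rightarrow> real) \<Rightarrow> real \<Rightarrow> bool" where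
  "is_first_systems_conjugate_point a r q p b \<longleftrightarrow>
     b \<in> systems_conjugate_points a r q p \<and>
     (\<forall>c \<in> systems_conjugate_points a r q p. b \<le> c)"

definition systems_conjugate ::
  "real \<Rightarrow> (real \<Rightarrow> real) \<Rightarrow> (real \<Rightarrow> real) \<Rightarrow> (real \<Rightarrow> real) \<Rightarrow> bool" where
  "systems_conjugate a r q p \<longleftrightarrow> (\<exists>b. is_first_systems_conjugate_point a r q p b)"

end

theory Submission
  imports Defs
begin

text \<open>
  The solutions with $y(a) = y_1(a) = 0$ form a plane, and \<open>b\<close> is conjugate to \<open>a\<close> exactly when the
  determinant \<open>D\<close> of $(y, y_1)$ on that plane vanishes at \<open>b\<close> (\<open>systems_conjugate_points_eq\<close>). As
  \<open>D\<close> is continuous and positive just after \<open>a\<close>, a first zero exists as soon as there is any zero.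

  Suppose there is none. The determinant \<open>W\<close> of $(y, y')$ on the plane starts at $0$ and satisfies
  $W' = D/r > 0$, so it has no zero either, and on the plane $y_1$ and $Ty$ are linear functions of
  $y$ and $y'$ on all of $(a, \<infinity>)$. Their coefficients satisfy a Riccati system (\<open>minors_satisfy_riccati\<close>).
  Its existence makes the functional
  \[ J(y) = \<integral> r y''^2 + q y'^2 - p y^2 \]
  nonnegative on functions for which $y$ and $y'$ vanish at both ends: by Picone's identity
  (\<open>form_increment_le\<close>) $J$ is then the integral of a square. The hypotheses on $r$ and $q$ contradict
  this. Let $z = y'$ rise from $0$ to $1$, stay there until $\<integral> q$ is very negative, and descend along
  $\<integral> 1/r$ so slowly that $\<integral> r z'^2$ is small. Then $\<integral> r z'^2 + q z^2 < 0$ for this bump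
  (\<open>form_bump\<close>), as in Leighton's oscillation criterion for $(r z')' = q z$. Two such bumps on
  disjoint intervals, with opposite signs and scaled so that $\<integral> z = 0$, bring $y$ back to $0$ and make
  $J$ negative (\<open>no_global_riccati_solution\<close>).

  Two classical facts on linear equations with continuous coefficients support this: global
  existence, by Picard's series (\<open>linear_ode_solution_exists\<close>), and uniqueness (\<open>quasi_system_zero\<close>).
\<close>

section \<open>Global solutions of linear equations\<close>

lemma integral_derivative_halfline:
  fixes f :: "real \<Rightarrow> 'a::banach"
  assumes "continuous_on {a..} f" "a \<le> x"
  shows "((\<lambda>t. integral {a..t} f) has_vector_derivative f x) (at x within {a..})"
proof -
  have "continuous_on {a..x+1} f"
    by (rule continuous_on_subset[OF assms(1)]) auto
  then have "((\<lambda>t. integral {a..t} f) has_vector_derivative f x) (at x within {a..x+1})"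
    by (rule integral_has_vector_derivative) (use assms in auto)
  moreover have "at x within {a..x+1} = at x within {a..}"
    by (rule at_within_nhd[of x "{..<x+1}"]) auto
  ultimately show ?thesis by simp
qed

lemma at_within_halfline:
  fixes a x :: real
  assumes "a < x"
  shows "at x within {a..} = at x"
  by (rule at_within_nhd[of x "{a<..}"]) (use assms in auto)

lemma has_vector_derivative_halfline_imp_continuous:
  assumes "\<And>x. a \<le> x \<Longrightarrow> (f has_vector_derivative f' x) (at x within {a..})"
  shows "continuous_on {a..} f"
  using assms by (meson atLeast_iff continuous_on_eq_continuous_within has_vector_derivative_continuous)

text \<open>
  The terms of the Neumann series of $X' = M X$, $X(a) = x_0$: their sum is the limit of the Picard
  iteration, and each term arises from its predecessor by applying $M$ and integrating.
\<close>

primrec picard_term :: "(real \<Rightarrow> 'a \<Rightarrow> 'a) \<Rightarrow> real \<Rightarrow> 'a \<Rightarrow> nat \<Rightarrow> real \<Rightarrow> 'a::banach" where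
  "picard_term M a x0 0 = (\<lambda>t. x0)"
| "picard_term M a x0 (Suc n) = (\<lambda>t. integral {a..t} (\<lambda>s. M s (picard_term M a x0 n s)))"

lemma picard_term_derivative:
  fixes M :: "real \<Rightarrow> 'a::banach \<Rightarrow> 'a"
  assumes cont: "\<And>X. continuous_on {a..} X \<Longrightarrow> continuous_on {a..} (\<lambda>t. M t (X t))"
    and "a \<le> t"
  shows "(picard_term M a x0 (Suc n) has_vector_derivative M t (picard_term M a x0 n t)) (at t within {a..})"
proof -
  have "continuous_on {a..} (picard_term M a x0 n)"
  proof (induction n)
    case (Suc n)
    show ?case
      by (rule has_vector_derivative_halfline_imp_continuous[of a _ "\<lambda>t. M t (picard_term M a x0 n t)"])
         (use integral_derivative_halfline[OF cont[OF Suc.IH]] in simp)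
  qed simp
  from integral_derivative_halfline[OF cont[OF this] \<open>a \<le> t\<close>] show ?thesis by simp
qed

lemma picard_term_bound:
  fixes M :: "real \<Rightarrow> 'a::banach \<Rightarrow> 'a"
  assumes cont: "\<And>X. continuous_on {a..} X \<Longrightarrow> continuous_on {a..} (\<lambda>t. M t (X t))"
    and K: "\<And>t x. a \<le> t \<Longrightarrow> t \<le> b \<Longrightarrow> norm (M t x) \<le> K * norm x" "0 \<le> K"
    and "a \<le> t" "t \<le> b"
  shows "norm (picard_term M a x0 n t) \<le> norm x0 * (K * (t - a)) ^ n / fact n"
  using \<open>a \<le> t\<close> \<open>t \<le> b\<close>
proof (induction n arbitrary: t)
  case (Suc n)
  show ?case
  proof (cases "a = t")
    case False
    with Suc.prems have "a < t" by simp
    let ?f = "picard_term M a x0"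
    let ?\<phi> = "\<lambda>s. norm x0 * (K * (s - a)) ^ Suc n / fact (Suc n)"
    let ?\<phi>' = "\<lambda>s. K * (norm x0 * (K * (s - a)) ^ n / fact n)"
    have "norm (?f (Suc n) t - ?f (Suc n) a) \<le> ?\<phi> t - ?\<phi> a"
    proof (rule differentiable_bound_general[OF \<open>a < t\<close>])
      have "continuous_on {a..} (?f (Suc n))"
        using picard_term_derivative[OF cont] by (rule has_vector_derivative_halfline_imp_continuous)
      then show "continuous_on {a..t} (?f (Suc n))"
        by (rule continuous_on_subset) auto
      show "continuous_on {a..t} ?\<phi>"
        by (intro continuous_intros) auto
    next
      fix s assume s: "a < s" "s < t"
      show "(?f (Suc n) has_vector_derivative M s (?f n s)) (at s)"
        using picard_term_derivative[OF cont, where t=s] s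
        by (simp add: at_within_halfline del: picard_term.simps)
      have "(?\<phi> has_real_derivative norm x0 * (real (Suc n) * (K * (s - a)) ^ n * K) / fact (Suc n)) (at s)"
        by (auto intro!: derivative_eq_intros simp del: fact_Suc power_Suc)
      moreover have "norm x0 * (real (Suc n) * (K * (s - a)) ^ n * K) / fact (Suc n) = ?\<phi>' s"
        by (simp add: field_simps del: of_nat_Suc)
      ultimately show "(?\<phi> has_vector_derivative ?\<phi>' s) (at s)"
        by (simp only: has_real_derivative_iff_has_vector_derivative)
      have "norm (M s (?f n s)) \<le> K * norm (?f n s)"
        using K s Suc.prems by auto
      also have "\<dots> \<le> ?\<phi>' s"
        using Suc.IH[of s] s Suc.prems K(2) by (intro mult_left_mono) auto
      finally show "norm (M s (?f n s)) \<le> ?\<phi>' s" .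
    qed
    then show ?thesis by simp
  qed simp
qed simp

text \<open>
  A linear equation has solutions on the whole half-line because the factorials in
  \<open>picard_term_bound\<close> beat every power, however long the interval. On each compact interval the series
  and the series of its derivatives converge uniformly. The series is the same for all intervals, so
  nothing has to be glued. The continuity hypothesis asks only that \<open>M\<close> preserve continuity of
  curves; this spares a topology on operators.
\<close>

lemma linear_ode_solution_exists:
  fixes M :: "real \<Rightarrow> 'a::banach \<Rightarrow> 'a"
  assumes lin: "\<And>t. a \<le> t \<Longrightarrow> bounded_linear (M t)"
    and cont: "\<And>X. continuous_on {a..} X \<Longrightarrow> continuous_on {a..} (\<lambda>t. M t (X t))"
    and bound: "\<And>b. \<exists>K. \<forall>t\<in>{a..b}. \<forall>x. norm (M t x) \<le> K * norm x"
  obtains X where "X a = x0" "\<And>t. a \<le> t \<Longrightarrow> (X has_vector_derivative M t (X t)) (at t within {a..})"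
proof -
  define X where "X = (\<lambda>t. \<Sum>n. picard_term M a x0 n t)"
  let ?f = "picard_term M a x0"
  have fa: "?f n a = (if n = 0 then x0 else 0)" for n
    by (cases n) auto
  have init: "X a = x0"
    unfolding X_def fa by (subst suminf_finite[of "{0}"]) auto
  have "(X has_vector_derivative M t (X t)) (at t within {a..})" if "a \<le> t" for t
  proof -
    define b where "b = t + 1"
    obtain K0 where K0: "\<And>s x. s \<in> {a..b} \<Longrightarrow> norm (M s x) \<le> K0 * norm x"
      using bound[of b] by blast
    define K where "K = max K0 0"
    have K: "norm (M s x) \<le> K * norm x" if "a \<le> s" "s \<le> b" for s x
    proof -
      have "norm (M s x) \<le> K0 * norm x" using K0 that by auto
      also have "\<dots> \<le> K * norm x" unfolding K_def by (intro mult_right_mono) auto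
      finally show ?thesis .
    qed
    have "0 \<le> K" by (simp add: K_def)
    define m where "m = (\<lambda>n. norm x0 * ((K * (b - a)) ^ n / fact n))"
    have m: "summable m"
      unfolding m_def
      using summable_exp_generic[of "K * (b - a)"] by (intro summable_mult) (simp add: field_simps)
    have f_le: "norm (?f n s) \<le> m n" if "s \<in> {a..b}" for n s
    proof -
      have "norm (?f n s) \<le> norm x0 * (K * (s - a)) ^ n / fact n"
        using that by (intro picard_term_bound[OF cont K \<open>0 \<le> K\<close>]) auto
      also have "\<dots> \<le> norm x0 * (K * (b - a)) ^ n / fact n"
        using that \<open>0 \<le> K\<close> by (intro divide_right_mono mult_left_mono power_mono) auto
      finally show ?thesis by (simp add: m_def)
    qed
    have f_summable: "summable (\<lambda>n. ?f n s)" if "s \<in> {a..b}" for s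
      using f_le[OF that] by (intro summable_comparison_test'[OF m]) auto
    \<comment> \<open>Derivatives of the series terms; the index is shifted since the first term is constant.\<close>
    let ?d = "\<lambda>n s. case n of 0 \<Rightarrow> 0 | Suc n \<Rightarrow> M s (?f n s)"
    let ?m = "\<lambda>n. case n of 0 \<Rightarrow> 0 | Suc n \<Rightarrow> K * m n"
    have "summable ?m"
      by (subst summable_Suc_iff[symmetric]) (use m in \<open>auto intro: summable_mult\<close>)
    have "norm (?d n s) \<le> ?m n" if "s \<in> {a..b}" for n s
    proof (cases n)
      case (Suc j)
      have "norm (M s (?f j s)) \<le> K * norm (?f j s)"
        using K that by auto
      also have "\<dots> \<le> K * m j"
        using f_le[OF that] \<open>0 \<le> K\<close> by (intro mult_left_mono) auto
      finally show ?thesis using Suc by simp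
    qed simp
    with \<open>summable ?m\<close>
    have "uniform_limit {a..b} (\<lambda>n s. \<Sum>i<n. ?d i s) (\<lambda>s. suminf (\<lambda>n. ?d n s)) sequentially"
      by (intro Weierstrass_m_test) auto
    moreover have d_sum: "suminf (\<lambda>n. ?d n s) = M s (X s)" if "s \<in> {a..b}" for s
    proof -
      have "bounded_linear (M s)" using lin that by auto
      then have "(\<lambda>n. M s (?f n s)) sums M s (X s)"
        unfolding X_def using summable_sums[OF f_summable[OF that]] by (rule bounded_linear.sums)
      then have "(\<lambda>n. ?d (Suc n) s) sums M s (X s)" by simp
      then have "(\<lambda>n. ?d n s) sums (M s (X s) + ?d 0 s)"
        by (simp only: sums_Suc_iff)
      then show ?thesis by (simp add: sums_iff)
    qed
    ultimately have lim: "uniform_limit {a..b} (\<lambda>n s. \<Sum>i<n. ?d i s) (\<lambda>s. M s (X s)) sequentially"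
      using uniform_limit_cong'[of "{a..b}" "\<lambda>n s. \<Sum>i<n. ?d i s" "\<lambda>n s. \<Sum>i<n. ?d i s"
        "\<lambda>s. suminf (\<lambda>n. ?d n s)" "\<lambda>s. M s (X s)"] by blast
    have "\<exists>g. \<forall>s\<in>{a..b}. (\<lambda>n. ?f n s) sums g s \<and>
            (g has_derivative (\<lambda>h. h *\<^sub>R M s (X s))) (at s within {a..b})"
    proof (rule has_derivative_series[where x = t and f' = "\<lambda>n s h. h *\<^sub>R ?d n s"])
      show "(?f n has_derivative (\<lambda>h. h *\<^sub>R ?d n s)) (at s within {a..b})" if "s \<in> {a..b}" for n s
      proof (cases n)
        case (Suc j)
        have "(?f (Suc j) has_vector_derivative M s (?f j s)) (at s within {a..})"
          using that by (intro picard_term_derivative[OF cont]) auto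
        then have "(?f (Suc j) has_vector_derivative M s (?f j s)) (at s within {a..b})"
          by (rule has_vector_derivative_within_subset) auto
        then show ?thesis unfolding Suc has_vector_derivative_def by simp
      qed simp
      fix e :: real assume "e > 0"
      with lim have "\<forall>\<^sub>F n in sequentially. \<forall>s\<in>{a..b}. dist (\<Sum>i<n. ?d i s) (M s (X s)) < e"
        by (auto simp: uniform_limit_iff)
      then show "\<forall>\<^sub>F n in sequentially. \<forall>s\<in>{a..b}. \<forall>h. norm ((\<Sum>i<n. h *\<^sub>R ?d i s) - h *\<^sub>R M s (X s)) \<le> e * norm h"
      proof eventually_elim
        case (elim n)
        show ?case
        proof (intro ballI allI)
          fix s h assume "s \<in> {a..b}"
          have "norm ((\<Sum>i<n. h *\<^sub>R ?d i s) - h *\<^sub>R M s (X s)) = norm ((\<Sum>i<n. ?d i s) - M s (X s)) * norm h"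
            by (simp only: scaleR_right.sum[symmetric] scaleR_right_diff_distrib[symmetric] norm_scaleR real_norm_def mult.commute)
          also have "\<dots> \<le> e * norm h"
            using elim \<open>s \<in> {a..b}\<close> by (intro mult_right_mono) (auto simp: dist_norm less_imp_le)
          finally show "norm ((\<Sum>i<n. h *\<^sub>R ?d i s) - h *\<^sub>R M s (X s)) \<le> e * norm h" .
        qed
      qed
    next
      show "t \<in> {a..b}" using \<open>a \<le> t\<close> by (simp add: b_def)
      then show "(\<lambda>n. ?f n t) sums X t"
        unfolding X_def by (intro summable_sums f_summable)
    qed simp
    then obtain g where g: "\<And>s. s \<in> {a..b} \<Longrightarrow> (\<lambda>n. ?f n s) sums g s"
      "\<And>s. s \<in> {a..b} \<Longrightarrow> (g has_vector_derivative M s (X s)) (at s within {a..b})"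
      unfolding has_vector_derivative_def by blast
    have "X s = g s" if "s \<in> {a..b}" for s
      using g(1)[OF that] unfolding X_def by (simp add: sums_iff)
    then have "(X has_vector_derivative M t (X t)) (at t within {a..b})"
      using \<open>a \<le> t\<close> by (intro has_vector_derivative_transform[OF _ _ g(2)]) (auto simp: b_def)
    moreover have "at t within {a..b} = at t within {a..}"
      by (rule at_within_nhd[of t "{..<t+1}"]) (auto simp: b_def)
    ultimately show "(X has_vector_derivative M t (X t)) (at t within {a..})" by simp
  qed
  with init show thesis by (rule that)
qed

section \<open>The first-order system\<close>

text \<open>
  The first-order form of the equation with \<open>z\<close> for $y'$, \<open>w\<close> for $y_1$ and \<open>T\<close> for $Ty$. Its
  coefficients $1/r$, $q$, $p$ are continuous, so it is an ordinary linear system although the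
  fourth-order equation cannot be expanded.
\<close>

definition quasi_system ::
  "real \<Rightarrow> (real \<Rightarrow> real) \<Rightarrow> (real \<Rightarrow> real) \<Rightarrow> (real \<Rightarrow> real) \<Rightarrow>
   (real \<Rightarrow> real) \<Rightarrow> (real \<Rightarrow> real) \<Rightarrow> (real \<Rightarrow> real) \<Rightarrow> (real \<Rightarrow> real) \<Rightarrow> bool" where
  "quasi_system a r q p y z w T \<longleftrightarrow>
     (\<forall>x\<ge>a. (y has_real_derivative z x) (at x within {a..}) \<and>
            (z has_real_derivative w x / r x) (at x within {a..}) \<and>
            (w has_real_derivative T x + q x * z x) (at x within {a..}) \<and>
            (T has_real_derivative p x * y x) (at x within {a..}))"

lemma quasi_systemD:
  assumes "quasi_system a r q p y z w T" "a \<le> x"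
  shows "(y has_real_derivative z x) (at x within {a..})"
    and "(z has_real_derivative w x / r x) (at x within {a..})"
    and "(w has_real_derivative T x + q x * z x) (at x within {a..})"
    and "(T has_real_derivative p x * y x) (at x within {a..})"
  using assms unfolding quasi_system_def by auto

lemma hderiv_eqI:
  assumes "(f has_real_derivative d) (at x within {a..})" "a \<le> x"
  shows "hderiv a f x = d"
proof -
  have "at x within {a..} \<noteq> bot"
    using at_le[of "{x..}" "{a..}" x] assms(2) trivial_limit_at_right_real[of x]
    unfolding at_within_Ici_at_right by (metis atLeast_subset_iff bot.extremum_uniqueI)
  then show ?thesis
    unfolding hderiv_def
    using assms by (intro vector_derivative_within) (auto simp: has_real_derivative_iff_has_vector_derivative)
qed

lemma C1_halfline_has_derivative:
  assumes "C1_halfline a f" "a \<le> x"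
  shows "(f has_real_derivative hderiv a f x) (at x within {a..})"
  using assms unfolding C1_halfline_def hderiv_def differentiable_on_def has_real_derivative_iff_has_vector_derivative
  by (simp add: vector_derivative_works)

lemma has_real_derivative_halfline_imp_continuous:
  fixes f :: "real \<Rightarrow> real"
  assumes "\<And>x. a \<le> x \<Longrightarrow> (f has_real_derivative f' x) (at x within {a..})"
  shows "continuous_on {a..} f"
  using has_vector_derivative_halfline_imp_continuous[of a f f'] assms
  by (simp add: has_real_derivative_iff_has_vector_derivative)

lemma C1_halflineI:
  assumes "\<And>x. a \<le> x \<Longrightarrow> (f has_real_derivative f' x) (at x within {a..})" "continuous_on {a..} f'"
  shows "C1_halfline a f"
proof -
  have "continuous_on {a..} (hderiv a f)"
    using assms(2) by (rule continuous_on_eq) (use assms(1) in \<open>metis atLeast_iff hderiv_eqI\<close>)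
  moreover have "f differentiable_on {a..}"
    using assms(1) unfolding differentiable_on_def by (auto simp: real_differentiable_def)
  ultimately show ?thesis by (simp add: C1_halfline_def)
qed

lemma has_real_derivative_halfline_cong:
  fixes f g :: "real \<Rightarrow> real"
  assumes "(f has_real_derivative d) (at x within {a..})" "a \<le> x" "\<And>t. a \<le> t \<Longrightarrow> g t = f t"
  shows "(g has_real_derivative d) (at x within {a..})"
  using assms has_vector_derivative_transform[of x "{a..}" g f d]
  by (simp add: has_real_derivative_iff_has_vector_derivative)

lemma continuous_on_inverse_coefficient:
  fixes r :: "real \<Rightarrow> real"
  assumes "\<And>x. a \<le> x \<Longrightarrow> r x > 0" "continuous_on {a..} r"
  shows "continuous_on {a..} (\<lambda>x. 1 / r x)"
  using assms by (intro continuous_on_divide continuous_on_const) (auto simp: less_imp_neq[symmetric])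

lemma is_solution_imp_quasi_system:
  assumes "is_solution a r q p y" "\<And>x. a \<le> x \<Longrightarrow> r x > 0"
  shows "quasi_system a r q p y (hderiv a y) (quasi1 a r y) (quasiT a r q y)"
proof -
  note sol = assms(1)[unfolded is_solution_def]
  show ?thesis
    unfolding quasi_system_def
  proof (intro allI impI conjI)
    fix x assume "a \<le> x"
    show "(y has_real_derivative hderiv a y x) (at x within {a..})"
      using sol \<open>a \<le> x\<close> by (blast intro: C1_halfline_has_derivative)
    have "quasi1 a r y x / r x = hderiv a (hderiv a y) x"
      using assms(2)[OF \<open>a \<le> x\<close>] by (simp add: quasi1_def)
    then show "(hderiv a y has_real_derivative quasi1 a r y x / r x) (at x within {a..})"
      using sol \<open>a \<le> x\<close> by (simp add: C1_halfline_has_derivative)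
    have "quasiT a r q y x + q x * hderiv a y x = hderiv a (quasi1 a r y) x"
      by (simp add: quasiT_def)
    then show "(quasi1 a r y has_real_derivative quasiT a r q y x + q x * hderiv a y x) (at x within {a..})"
      using sol \<open>a \<le> x\<close> by (simp add: C1_halfline_has_derivative)
    show "(quasiT a r q y has_real_derivative p x * y x) (at x within {a..})"
      using sol \<open>a \<le> x\<close> C1_halfline_has_derivative[of a "quasiT a r q y" x] by simp
  qed
qed

lemma quasi_system_imp_is_solution:
  assumes sys: "quasi_system a r q p y z w T"
    and pos: "\<And>x. a \<le> x \<Longrightarrow> r x > 0"
    and cont: "continuous_on {a..} r" "continuous_on {a..} q" "continuous_on {a..} p"
  shows "is_solution a r q p y" "\<And>x. a \<le> x \<Longrightarrow> quasi1 a r y x = w x"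
proof -
  note d = quasi_systemD[OF sys]
  note c = d[THEN has_real_derivative_halfline_imp_continuous]
  have z: "hderiv a y x = z x" if "a \<le> x" for x
    using d(1)[OF that] that by (rule hderiv_eqI)
  have dz: "(hderiv a y has_real_derivative w x / r x) (at x within {a..})" if "a \<le> x" for x
    using d(2)[OF that] that z by (rule has_real_derivative_halfline_cong)
  show w: "quasi1 a r y x = w x" if "a \<le> x" for x
    using hderiv_eqI[OF dz that] that pos[OF that] by (simp add: quasi1_def)
  have dw: "(quasi1 a r y has_real_derivative T x + q x * z x) (at x within {a..})" if "a \<le> x" for x
    using d(3)[OF that] that w by (rule has_real_derivative_halfline_cong)
  have T: "quasiT a r q y x = T x" if "a \<le> x" for x
    using hderiv_eqI[OF dw that] that z by (simp add: quasiT_def)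
  have dT: "(quasiT a r q y has_real_derivative p x * y x) (at x within {a..})" if "a \<le> x" for x
    using d(4)[OF that] that T by (rule has_real_derivative_halfline_cong)
  have "C1_halfline a y" using d(1) c(2) by (rule C1_halflineI)
  moreover have "C1_halfline a (hderiv a y)"
    using dz continuous_on_mult[OF c(3) continuous_on_inverse_coefficient[OF pos cont(1)]]
    by (intro C1_halflineI[of a _ "\<lambda>x. w x / r x"]) simp_all
  moreover have "C1_halfline a (quasi1 a r y)"
    using dw continuous_on_add[OF c(4) continuous_on_mult[OF cont(2) c(2)]] by (rule C1_halflineI)
  moreover have "C1_halfline a (quasiT a r q y)"
    using dT continuous_on_mult[OF cont(3) c(1)] by (rule C1_halflineI)
  moreover have "hderiv a (quasiT a r q y) x = p x * y x" if "a \<le> x" for x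
    using dT that by (simp add: hderiv_eqI)
  ultimately show "is_solution a r q p y" by (simp add: is_solution_def)
qed

lemma continuous_on_halfline_bounded:
  fixes f :: "real \<Rightarrow> real"
  assumes "continuous_on {a..} f"
  obtains K where "0 \<le> K" "\<And>x. a \<le> x \<Longrightarrow> x \<le> b \<Longrightarrow> \<bar>f x\<bar> \<le> K"
proof -
  have "compact (f ` {a..b})"
    by (intro compact_continuous_image continuous_on_subset[OF assms]) auto
  then obtain K where "\<And>x. x \<in> {a..b} \<Longrightarrow> \<bar>f x\<bar> \<le> K"
    using compact_imp_bounded[of "f ` {a..b}"] unfolding bounded_iff by (metis imageI real_norm_def)
  then show ?thesis by (intro that[of "max K 0"]) (auto simp: le_max_iff_disj)
qed

text \<open>
  The four equations are one linear equation in $\<real>^4$ whose operator norm is bounded on compact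
  intervals, so Picard's series applies.
\<close>

lemma quasi_system_exists:
  assumes pos: "\<And>x. a \<le> x \<Longrightarrow> r x > 0"
    and cont: "continuous_on {a..} r" "continuous_on {a..} q" "continuous_on {a..} p"
  obtains y z w T where "quasi_system a r q p y z w T" "y a = y0" "z a = z0" "w a = w0" "T a = T0"
proof -
  define M :: "real \<Rightarrow> real \<times> real \<times> real \<times> real \<Rightarrow> real \<times> real \<times> real \<times> real" where
    "M = (\<lambda>t (y, z, w, T). (z, 1 / r t * w, T + q t * z, p t * y))"
  note cont' = continuous_on_inverse_coefficient[OF pos cont(1)]
  have M_eq: "M t X = (fst (snd X), 1 / r t * fst (snd (snd X)),
      snd (snd (snd X)) + q t * fst (snd X), p t * fst X)" for t X
    by (simp add: M_def split: prod.splits)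
  obtain X where X: "X a = (y0, z0, w0, T0)"
    "\<And>t. a \<le> t \<Longrightarrow> (X has_vector_derivative M t (X t)) (at t within {a..})"
  proof (rule linear_ode_solution_exists[of a M "(y0, z0, w0, T0)"])
    show "bounded_linear (M t)" for t
      unfolding M_eq
      by (intro bounded_linear_Pair bounded_linear_add bounded_linear_const_mult
          bounded_linear_fst_comp bounded_linear_snd_comp bounded_linear_ident)
    show "continuous_on {a..} (\<lambda>t. M t (X t))" if "continuous_on {a..} X" for X
      unfolding M_eq by (intro continuous_intros that cont cont')
  next
    fix b
    obtain Kr where Kr: "0 \<le> Kr" "\<And>x. a \<le> x \<Longrightarrow> x \<le> b \<Longrightarrow> \<bar>1 / r x\<bar> \<le> Kr"
      using continuous_on_halfline_bounded[OF cont', of b] by metis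
    obtain Kq where Kq: "0 \<le> Kq" "\<And>x. a \<le> x \<Longrightarrow> x \<le> b \<Longrightarrow> \<bar>q x\<bar> \<le> Kq"
      using continuous_on_halfline_bounded[OF cont(2), of b] by metis
    obtain Kp where Kp: "0 \<le> Kp" "\<And>x. a \<le> x \<Longrightarrow> x \<le> b \<Longrightarrow> \<bar>p x\<bar> \<le> Kp"
      using continuous_on_halfline_bounded[OF cont(3), of b] by metis
    have "norm (M t X) \<le> (2 + Kr + Kq + Kp) * norm X" if t: "t \<in> {a..b}" for t X
    proof -
      obtain y z w T where Xe: "X = (y, z, w, T)" by (cases X)
      have le: "\<bar>y\<bar> \<le> norm X" "\<bar>z\<bar> \<le> norm X" "\<bar>w\<bar> \<le> norm X" "\<bar>T\<bar> \<le> norm X"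
        using norm_fst_le[of y "(z, w, T)"] norm_snd_le[of "(z, w, T)" y]
          norm_fst_le[of z "(w, T)"] norm_snd_le[of "(w, T)" z]
          norm_fst_le[of w T] norm_snd_le[of T w] unfolding Xe by auto
      have "norm (M t X) \<le> \<bar>z\<bar> + (\<bar>1 / r t * w\<bar> + (\<bar>T + q t * z\<bar> + \<bar>p t * y\<bar>))"
        unfolding M_eq Xe fst_conv snd_conv real_norm_def[symmetric]
        by (intro order_trans[OF norm_Pair_le] add_left_mono order_refl)
      also have "\<dots> \<le> norm X + (Kr * norm X + ((norm X + Kq * norm X) + Kp * norm X))"
        using t le Kr Kq Kp unfolding abs_mult
        by (intro add_mono order_trans[OF abs_triangle_ineq] mult_mono) (auto simp: abs_mult intro!: add_mono mult_mono)
      finally show ?thesis by (simp add: algebra_simps)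
    qed
    then show "\<exists>K. \<forall>t\<in>{a..b}. \<forall>X. norm (M t X) \<le> K * norm X" by blast
  qed blast
  show thesis
  proof (rule that)
    show "quasi_system a r q p (\<lambda>t. fst (X t)) (\<lambda>t. fst (snd (X t)))
        (\<lambda>t. fst (snd (snd (X t)))) (\<lambda>t. snd (snd (snd (X t))))"
      unfolding quasi_system_def has_real_derivative_iff_has_vector_derivative
    proof (intro allI impI)
      fix t assume "a \<le> t"
      note d = X(2)[OF this]
      note d1 = bounded_linear.has_vector_derivative[OF bounded_linear_snd d]
      note d2 = bounded_linear.has_vector_derivative[OF bounded_linear_snd d1]
      show "((\<lambda>t. fst (X t)) has_vector_derivative fst (snd (X t))) (at t within {a..}) \<and>
        ((\<lambda>t. fst (snd (X t))) has_vector_derivative fst (snd (snd (X t))) / r t) (at t within {a..}) \<and>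
        ((\<lambda>t. fst (snd (snd (X t)))) has_vector_derivative
           snd (snd (snd (X t))) + q t * fst (snd (X t))) (at t within {a..}) \<and>
        ((\<lambda>t. snd (snd (snd (X t)))) has_vector_derivative p t * fst (X t)) (at t within {a..})"
        using bounded_linear.has_vector_derivative[OF bounded_linear_fst d]
          bounded_linear.has_vector_derivative[OF bounded_linear_fst d1]
          bounded_linear.has_vector_derivative[OF bounded_linear_fst d2]
          bounded_linear.has_vector_derivative[OF bounded_linear_snd d2]
        by (simp add: M_eq)
    qed
  qed (simp_all add: X(1))
qed

lemma quasi_system_linear:
  assumes "quasi_system a r q p y1 z1 w1 T1" "quasi_system a r q p y2 z2 w2 T2"
  shows "quasi_system a r q p (\<lambda>x. c * y1 x + d * y2 x) (\<lambda>x. c * z1 x + d * z2 x)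
     (\<lambda>x. c * w1 x + d * w2 x) (\<lambda>x. c * T1 x + d * T2 x)"
  unfolding quasi_system_def
proof (intro allI impI conjI)
  fix x assume "a \<le> x"
  note d1 = quasi_systemD[OF assms(1) this] and d2 = quasi_systemD[OF assms(2) this]
  note comb = DERIV_add[OF DERIV_cmult[of _ _ _ _ c] DERIV_cmult[of _ _ _ _ d]]
  show "((\<lambda>x. c * y1 x + d * y2 x) has_real_derivative c * z1 x + d * z2 x) (at x within {a..})"
    using comb[OF d1(1) d2(1)] .
  show "((\<lambda>x. c * z1 x + d * z2 x) has_real_derivative (c * w1 x + d * w2 x) / r x) (at x within {a..})"
    using comb[OF d1(2) d2(2)] by (simp add: add_divide_distrib)
  show "((\<lambda>x. c * w1 x + d * w2 x) has_real_derivative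
      (c * T1 x + d * T2 x) + q x * (c * z1 x + d * z2 x)) (at x within {a..})"
    using comb[OF d1(3) d2(3)] by (simp add: algebra_simps)
  show "((\<lambda>x. c * T1 x + d * T2 x) has_real_derivative p x * (c * y1 x + d * y2 x)) (at x within {a..})"
    using comb[OF d1(4) d2(4)] by (simp add: algebra_simps)
qed

text \<open>
  Gronwall's argument: all coefficients are bounded on $[a,b]$, so the squared length \<open>E\<close> of the
  solution satisfies $E' \<le> K E$, and $E e^{-Kx}$ cannot increase from its initial value $0$.
\<close>

lemma quasi_system_zero:
  assumes sys: "quasi_system a r q p y z w T"
    and pos: "\<And>x. a \<le> x \<Longrightarrow> r x > 0"
    and cont: "continuous_on {a..} r" "continuous_on {a..} q" "continuous_on {a..} p"
    and zero: "y a = 0" "z a = 0" "w a = 0" "T a = 0"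
    and "a \<le> b"
  shows "y b = 0" "w b = 0"
proof -
  note d = quasi_systemD[OF sys]
  note c = d[THEN has_real_derivative_halfline_imp_continuous]
  note cont' = continuous_on_inverse_coefficient[OF pos cont(1)]
  obtain Kr where Kr: "0 \<le> Kr" "\<And>x. a \<le> x \<Longrightarrow> x \<le> b \<Longrightarrow> \<bar>1 / r x\<bar> \<le> Kr"
    using continuous_on_halfline_bounded[OF cont', of b] by metis
  obtain Kq where Kq: "0 \<le> Kq" "\<And>x. a \<le> x \<Longrightarrow> x \<le> b \<Longrightarrow> \<bar>q x\<bar> \<le> Kq"
    using continuous_on_halfline_bounded[OF cont(2), of b] by metis
  obtain Kp where Kp: "0 \<le> Kp" "\<And>x. a \<le> x \<Longrightarrow> x \<le> b \<Longrightarrow> \<bar>p x\<bar> \<le> Kp"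
    using continuous_on_halfline_bounded[OF cont(3), of b] by metis
  define K where "K = 2 + Kr + Kq + Kp"
  define E where "E = (\<lambda>x. (y x)\<^sup>2 + (z x)\<^sup>2 + (w x)\<^sup>2 + (T x)\<^sup>2)"
  define E' where "E' = (\<lambda>x. 2 * (y x * z x) + 2 * (1 / r x * (z x * w x)) +
     2 * (w x * T x) + 2 * (q x * (w x * z x)) + 2 * (p x * (T x * y x)))"
  have prod: "2 * (k * (s * t)) \<le> k0 * (s\<^sup>2 + t\<^sup>2)" if "\<bar>k\<bar> \<le> k0" for k k0 s t :: real
  proof -
    have "2 * (k * (s * t)) \<le> \<bar>k\<bar> * (2 * \<bar>s * t\<bar>)"
      by (metis abs_ge_self abs_mult mult.left_commute mult_left_mono zero_le_numeral)
    also have "\<dots> \<le> k0 * (s\<^sup>2 + t\<^sup>2)"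
      using sum_squares_bound[of "\<bar>s\<bar>" "\<bar>t\<bar>"] that
      by (intro mult_mono) (auto simp: abs_mult mult.assoc)
    finally show ?thesis .
  qed
  have "E b * exp (- K * b) \<le> E a * exp (- K * a)"
  proof (rule DERIV_nonpos_imp_decreasing_open[OF \<open>a \<le> b\<close>, of "\<lambda>x. E x * exp (- K * x)"])
    fix x assume x: "a < x" "x < b"
    have "(E has_real_derivative E' x) (at x)"
      unfolding E_def E'_def
      by (rule derivative_eq_intros d[of x, unfolded at_within_halfline[OF x(1)]] refl
          | use x in \<open>simp add: algebra_simps; fail\<close>)+
    then have "((\<lambda>x. E x * exp (- K * x)) has_real_derivative (E' x - K * E x) * exp (- K * x)) (at x)"
      by (auto intro!: derivative_eq_intros simp: algebra_simps)
    moreover have "E' x \<le> K * E x"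
    proof -
      have "E' x \<le> 1 * ((y x)\<^sup>2 + (z x)\<^sup>2) + Kr * ((z x)\<^sup>2 + (w x)\<^sup>2) + 1 * ((w x)\<^sup>2 + (T x)\<^sup>2)
          + Kq * ((w x)\<^sup>2 + (z x)\<^sup>2) + Kp * ((T x)\<^sup>2 + (y x)\<^sup>2)"
        unfolding E'_def
        using prod[of 1 1 "y x" "z x"] prod[of 1 1 "w x" "T x"] prod[OF Kr(2), of x "z x" "w x"]
          prod[OF Kq(2), of x "w x" "z x"] prod[OF Kp(2), of x "T x" "y x"] x by auto
      also have "\<dots> \<le> 1 * E x + Kr * E x + 1 * E x + Kq * E x + Kp * E x"
        using Kr(1) Kq(1) Kp(1) by (intro add_mono mult_left_mono) (auto simp: E_def)
      finally show ?thesis by (simp add: K_def algebra_simps)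
    qed
    ultimately show "\<exists>y. ((\<lambda>x. E x * exp (- K * x)) has_real_derivative y) (at x) \<and> y \<le> 0"
      by (intro exI conjI) (auto simp: mult_le_0_iff)
  next
    have "continuous_on {a..b} y" "continuous_on {a..b} z" "continuous_on {a..b} w" "continuous_on {a..b} T"
      using c by (auto intro: continuous_on_subset)
    then show "continuous_on {a..b} (\<lambda>x. E x * exp (- K * x))"
      unfolding E_def by (intro continuous_intros)
  qed
  then have "E b \<le> 0" using zero by (simp add: E_def mult_le_0_iff)
  then have "(y b)\<^sup>2 = 0 \<and> (w b)\<^sup>2 = 0"
    unfolding E_def using zero_le_power2[of "y b"] zero_le_power2[of "z b"] zero_le_power2[of "w b"] zero_le_power2[of "T b"]
    by linarith
  then show "y b = 0" "w b = 0" by auto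
qed

lemma zero_function_derivative:
  assumes "(f has_real_derivative d) (at x within {a..})" "a \<le> x" "\<And>t. a \<le> t \<Longrightarrow> f t = 0"
  shows "d = 0"
proof -
  have "((\<lambda>_. 0) has_real_derivative d) (at x within {a..})"
    using assms(1,2) by (rule has_real_derivative_halfline_cong) (simp add: assms(3))
  then show ?thesis
    using hderiv_eqI[of "\<lambda>_. 0" d x a] hderiv_eqI[of "\<lambda>_. 0" 0 x a] assms(2) by simp
qed

lemma quasi_system_trivial:
  assumes sys: "quasi_system a r q p y z w T" and pos: "\<And>x. a \<le> x \<Longrightarrow> r x > 0"
    and y: "\<And>x. a \<le> x \<Longrightarrow> y x = 0"
  shows "z a = 0" "T a = 0"
proof -
  note d = quasi_systemD[OF sys]
  have z: "z x = 0" if "a \<le> x" for x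
    using zero_function_derivative[OF d(1)[OF that] that y] .
  have w: "w x = 0" if "a \<le> x" for x
    using zero_function_derivative[OF d(2)[OF that] that z] pos[OF that] by simp
  show "z a = 0" "T a = 0"
    using zero_function_derivative[OF d(3)[of a] _ w] z[of a] by auto
qed

section \<open>The Riccati system and its quadratic form\<close>

text \<open>
  The matrix $\<langle>\<langle>-h, -k\<rangle>, \<langle>-k, g\<rangle>\<rangle>$ takes $(y, y')$ to $(-Ty, y_1)$ on a plane of solutions on which
  $(y, y')$ serve as coordinates: there $y_1 = g y' - k y$ and $Ty = h y + k y'$. Substituting this
  into the first-order system gives the three equations below.
\<close>

locale riccati_halfline =
  fixes a :: real and r q p g k h :: "real \<Rightarrow> real"
  assumes cont_r: "continuous_on {a..} r" and cont_q: "continuous_on {a..} q"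
    and r_pos: "\<And>x. a \<le> x \<Longrightarrow> r x > 0" and p_pos: "\<And>x. a \<le> x \<Longrightarrow> p x > 0"
    and g_deriv: "\<And>x. a < x \<Longrightarrow> (g has_real_derivative q x + 2 * k x - (g x)\<^sup>2 / r x) (at x)"
    and k_deriv: "\<And>x. a < x \<Longrightarrow> (k has_real_derivative - h x - k x * g x / r x) (at x)"
    and h_deriv: "\<And>x. a < x \<Longrightarrow> (h has_real_derivative p x + (k x)\<^sup>2 / r x) (at x)"
begin

text \<open>
  The quadratic form of that matrix. Along a solution in the plane it equals $y' y_1 - y\,Ty$, the
  boundary term in the integration by parts of $\<integral> r y''^2 + q y'^2 - p y^2$.
\<close>

definition form :: "real \<Rightarrow> real \<Rightarrow> real \<Rightarrow> real" where
  "form x y z = g x * z\<^sup>2 - 2 * k x * y * z - h x * y\<^sup>2"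

text \<open>
  Picone's identity: for an arbitrary $y$ with $z = y'$,
  \[ \frac{d}{dx}\,\mathit{form}(x, y, z)
     = r z'^2 + q z^2 - p y^2 - r \Bigl(z' - \frac{g z - k y}{r}\Bigr)^2 . \]
  The two subtracted terms are nonnegative, so any \<open>G\<close> whose derivative dominates $r z'^2 + q z^2$
  bounds the growth of the form.
\<close>

lemma form_increment_le:
  assumes "a < \<alpha>" "\<alpha> \<le> \<beta>"
    and y: "\<And>x. \<alpha> \<le> x \<Longrightarrow> x \<le> \<beta> \<Longrightarrow> (y has_real_derivative z x) (at x)"
    and z: "\<And>x. \<alpha> \<le> x \<Longrightarrow> x \<le> \<beta> \<Longrightarrow> (z has_real_derivative z' x) (at x)"
    and G: "\<And>x. \<alpha> \<le> x \<Longrightarrow> x \<le> \<beta> \<Longrightarrow> (G has_real_derivative G' x) (at x)"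
    and le: "\<And>x. \<alpha> \<le> x \<Longrightarrow> x \<le> \<beta> \<Longrightarrow> r x * (z' x)\<^sup>2 + q x * (z x)\<^sup>2 \<le> G' x"
  shows "form \<beta> (y \<beta>) (z \<beta>) - form \<alpha> (y \<alpha>) (z \<alpha>) \<le> G \<beta> - G \<alpha>"
proof -
  let ?N = "\<lambda>x. form x (y x) (z x) - G x"
  have "?N \<beta> \<le> ?N \<alpha>"
  proof (rule DERIV_nonpos_imp_nonincreasing[OF \<open>\<alpha> \<le> \<beta>\<close>])
    fix x assume x: "\<alpha> \<le> x" "x \<le> \<beta>"
    with \<open>a < \<alpha>\<close> have "a < x" by simp
    then have r: "r x > 0" and p: "p x > 0" using r_pos p_pos by auto
    let ?d = "(q x + 2 * k x - (g x)\<^sup>2 / r x) * (z x)\<^sup>2 + g x * (2 * z x * z' x)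
        - 2 * ((- h x - k x * g x / r x) * (y x * z x) + k x * (z x * z x + y x * z' x))
        - ((p x + (k x)\<^sup>2 / r x) * (y x)\<^sup>2 + h x * (2 * y x * z x)) - G' x"
    have "(?N has_real_derivative ?d) (at x)"
      unfolding form_def
      by (rule derivative_eq_intros g_deriv[OF \<open>a < x\<close>] k_deriv[OF \<open>a < x\<close>] h_deriv[OF \<open>a < x\<close>]
          y[OF x] z[OF x] G[OF x] refl)+ (simp add: algebra_simps)
    moreover have "?d = (r x * (z' x)\<^sup>2 + q x * (z x)\<^sup>2 - G' x) - p x * (y x)\<^sup>2
        - r x * (z' x - (g x * z x - k x * y x) / r x)\<^sup>2"
    proof -
      have square: "r x * (z' x - m / r x)\<^sup>2 = r x * (z' x)\<^sup>2 - 2 * z' x * m + m\<^sup>2 / r x" for m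
        using r by (simp add: field_simps power2_eq_square)
      show ?thesis
        unfolding square by (simp add: algebra_simps add_divide_distrib diff_divide_distrib power2_eq_square)
    qed
    moreover have "\<dots> \<le> 0"
    proof -
      have "0 \<le> p x * (y x)\<^sup>2" "0 \<le> r x * (z' x - (g x * z x - k x * y x) / r x)\<^sup>2"
        using p r by auto
      with le[OF x] show ?thesis by linarith
    qed
    ultimately show "\<exists>d. (?N has_real_derivative d) (at x) \<and> d \<le> 0" by metis
  qed
  then show ?thesis by simp
qed

definition R :: "real \<Rightarrow> real" where "R x = integral {a..x} (\<lambda>t. 1 / r t)"
definition Q :: "real \<Rightarrow> real" where "Q x = integral {a..x} q"

lemma integral_derivative:
  fixes f :: "real \<Rightarrow> real"
  assumes "continuous_on {a..} f" "a < x"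
  shows "((\<lambda>t. integral {a..t} f) has_real_derivative f x) (at x)"
  using integral_derivative_halfline[of a f x] assms
  by (simp add: has_real_derivative_iff_has_vector_derivative at_within_halfline)

lemma R_deriv: "a < x \<Longrightarrow> (R has_real_derivative 1 / r x) (at x)"
  unfolding R_def using integral_derivative[OF continuous_on_inverse_coefficient[OF r_pos cont_r]] by simp

lemma Q_deriv: "a < x \<Longrightarrow> (Q has_real_derivative q x) (at x)"
  unfolding Q_def using integral_derivative[OF cont_q] by simp

lemma R_strict_mono:
  assumes "a < \<alpha>" "\<alpha> < \<beta>"
  shows "R \<alpha> < R \<beta>"
proof (rule DERIV_pos_imp_increasing[OF \<open>\<alpha> < \<beta>\<close>])
  fix x assume "\<alpha> \<le> x"
  then show "\<exists>d. (R has_real_derivative d) (at x) \<and> 0 < d"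
    using R_deriv[of x] r_pos[of x] assms(1) by (intro exI[of _ "1 / r x"]) auto
qed

lemma continuous_R: "continuous_on {a..} R"
  unfolding R_def
  using integral_derivative_halfline[OF continuous_on_inverse_coefficient[OF r_pos cont_r]]
  by (rule has_vector_derivative_halfline_imp_continuous)

lemma integral_diff_pos:
  assumes "continuous_on {a..} f" "a < \<alpha>" "\<alpha> < \<beta>" "\<And>x. \<alpha> < x \<Longrightarrow> x < \<beta> \<Longrightarrow> f x > (0::real)"
  shows "integral {a..\<alpha>} f < integral {a..\<beta>} f"
proof (rule DERIV_pos_imp_increasing_open[OF \<open>\<alpha> < \<beta>\<close>])
  show "\<exists>d. ((\<lambda>t. integral {a..t} f) has_real_derivative d) (at x) \<and> 0 < d" if "\<alpha> < x" "x < \<beta>" for x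
    using integral_derivative[OF assms(1), of x] assms(2,4) that by (intro exI conjI) auto
  show "continuous_on {\<alpha>..\<beta>} (\<lambda>t. integral {a..t} f)"
    using assms(2)
    by (intro DERIV_continuous_on[where D = f] has_field_derivative_at_within[OF integral_derivative[OF assms(1)]]) auto
qed

text \<open>
  The rising flank of a test function: $z$ goes from $0$ to $c$ while $y$ gains \<open>c * I\<close>. Its cost $K$
  need not be small, but it is fixed before the length of the plateau is chosen.
\<close>

lemma form_rise:
  assumes "a < \<alpha>" "\<alpha> < \<beta>"
  obtains K I where "I > 0" "\<And>y0 c. form \<beta> (y0 + c * I) c \<le> form \<alpha> y0 0 + c\<^sup>2 * K"
proof -
  define L where "L = R \<beta> - R \<alpha>"
  have "L > 0" using R_strict_mono[OF assms] by (simp add: L_def)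
  define \<zeta> where "\<zeta> = (\<lambda>x. (R x - R \<alpha>) / L)"
  define e where "e = (\<lambda>x. 1 / r x / L\<^sup>2 + q x * (\<zeta> x)\<^sup>2)"
  have cont_\<zeta>: "continuous_on {a..} \<zeta>"
    unfolding \<zeta>_def using \<open>L > 0\<close> by (intro continuous_intros continuous_R) auto
  have cont_e: "continuous_on {a..} e"
    unfolding e_def
    using \<open>L > 0\<close>
    by (intro continuous_on_add continuous_on_mult continuous_on_power continuous_on_divide[of _ "\<lambda>x. 1 / r x"]
        continuous_on_const continuous_on_inverse_coefficient r_pos cont_r cont_q cont_\<zeta>) auto
  define S where "S = (\<lambda>x. integral {a..x} \<zeta> - integral {a..\<alpha>} \<zeta>)"
  have S_deriv: "(S has_real_derivative \<zeta> x) (at x)" if "a < x" for x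
    unfolding S_def using integral_derivative[OF cont_\<zeta> that] by (auto intro!: derivative_eq_intros)
  have \<zeta>_deriv: "(\<zeta> has_real_derivative 1 / r x / L) (at x)" if "a < x" for x
    unfolding \<zeta>_def using R_deriv[OF that] \<open>L > 0\<close> by (auto intro!: derivative_eq_intros)
  have ends: "\<zeta> \<alpha> = 0" "\<zeta> \<beta> = 1" "S \<alpha> = 0"
    using \<open>L > 0\<close> by (simp_all add: \<zeta>_def S_def L_def)
  show thesis
  proof (rule that)
    show "S \<beta> > 0"
      unfolding S_def using integral_diff_pos[OF cont_\<zeta> assms] R_strict_mono assms \<open>L > 0\<close>
      by (auto simp: \<zeta>_def)
    fix y0 c
    have "form \<beta> (y0 + c * S \<beta>) (c * \<zeta> \<beta>) - form \<alpha> (y0 + c * S \<alpha>) (c * \<zeta> \<alpha>)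
        \<le> c\<^sup>2 * integral {a..\<beta>} e - c\<^sup>2 * integral {a..\<alpha>} e"
    proof (rule form_increment_le[where z' = "\<lambda>x. c * (1 / r x / L)" and G' = "\<lambda>x. c\<^sup>2 * e x"])
      fix x assume "\<alpha> \<le> x" "x \<le> \<beta>"
      with assms have x: "a < x" by simp
      show "((\<lambda>x. y0 + c * S x) has_real_derivative c * \<zeta> x) (at x)"
        using S_deriv[OF x] by (auto intro!: derivative_eq_intros)
      show "((\<lambda>x. c * \<zeta> x) has_real_derivative c * (1 / r x / L)) (at x)"
        using \<zeta>_deriv[OF x] by (rule DERIV_cmult)
      show "((\<lambda>x. c\<^sup>2 * integral {a..x} e) has_real_derivative c\<^sup>2 * e x) (at x)"
        using integral_derivative[OF cont_e x] by (rule DERIV_cmult)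
      show "r x * (c * (1 / r x / L))\<^sup>2 + q x * (c * \<zeta> x)\<^sup>2 \<le> c\<^sup>2 * e x"
        using r_pos[of x] x by (simp add: e_def field_simps power2_eq_square)
    qed (use assms in auto)
    then show "form \<beta> (y0 + c * S \<beta>) c \<le> form \<alpha> y0 0 + c\<^sup>2 * (integral {a..\<beta>} e - integral {a..\<alpha>} e)"
      by (simp add: ends algebra_simps)
  qed
qed

text \<open>
  With $z$ constant the cost is $c^2 \<integral> q$, which becomes arbitrarily negative on a long plateau.
\<close>

lemma form_plateau:
  assumes "a < \<alpha>" "\<alpha> \<le> \<beta>"
  shows "form \<beta> (y0 + c * (\<beta> - \<alpha>)) c \<le> form \<alpha> y0 c + c\<^sup>2 * (Q \<beta> - Q \<alpha>)"
proof -
  have "form \<beta> (y0 + c * (\<beta> - \<alpha>)) c - form \<alpha> (y0 + c * (\<alpha> - \<alpha>)) c \<le> c\<^sup>2 * Q \<beta> - c\<^sup>2 * Q \<alpha>"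
  proof (rule form_increment_le[where z' = "\<lambda>x. 0" and G' = "\<lambda>x. c\<^sup>2 * q x" and z = "\<lambda>x. c"])
    fix x assume "\<alpha> \<le> x" "x \<le> \<beta>"
    with assms have x: "a < x" by simp
    show "((\<lambda>x. c\<^sup>2 * Q x) has_real_derivative c\<^sup>2 * q x) (at x)"
      using Q_deriv[OF x] by (rule DERIV_cmult)
  qed (use assms in \<open>auto intro!: derivative_eq_intros\<close>)
  then show ?thesis by (simp add: algebra_simps)
qed

text \<open>
  The falling flank. Taking $z$ affine in $\<integral> 1/r$ reduces $\<integral> r z'^2$ to $c^2/L$, where \<open>L\<close> is the
  increment of $\<integral> 1/r$; this is where divergence of that integral makes the descent cheap. As $q$ may
  change sign, $\<integral> q z^2$ is controlled by parts: $z^2$ decreases, so the upper bound $-M$ for the primitive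
  \<open>Q\<close> on the flank suffices. The term $- Q \beta$ cancels against the gain of the plateau, which leaves
  $-M$ for the two pieces together, apart from the value of \<open>Q\<close> where the plateau begins.
\<close>

lemma form_descent:
  assumes "a < \<beta>" "\<beta> < \<gamma>" and Q_le: "\<And>x. \<beta> \<le> x \<Longrightarrow> x \<le> \<gamma> \<Longrightarrow> Q x \<le> - M"
  obtains I where "I > 0"
    "\<And>y0 c. form \<gamma> (y0 + c * I) 0 \<le> form \<beta> y0 c + c\<^sup>2 * (1 / (R \<gamma> - R \<beta>) - M - Q \<beta>)"
proof -
  define L where "L = R \<gamma> - R \<beta>"
  have "L > 0" using R_strict_mono[OF assms(1,2)] by (simp add: L_def)
  define \<zeta> where "\<zeta> = (\<lambda>x. (R \<gamma> - R x) / L)"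
  have cont_\<zeta>: "continuous_on {a..} \<zeta>"
    unfolding \<zeta>_def using \<open>L > 0\<close> by (intro continuous_intros continuous_R) auto
  define S where "S = (\<lambda>x. integral {a..x} \<zeta> - integral {a..\<beta>} \<zeta>)"
  have S_deriv: "(S has_real_derivative \<zeta> x) (at x)" if "a < x" for x
    unfolding S_def using integral_derivative[OF cont_\<zeta> that] by (auto intro!: derivative_eq_intros)
  have \<zeta>_deriv: "(\<zeta> has_real_derivative - (1 / r x / L)) (at x)" if "a < x" for x
    unfolding \<zeta>_def using R_deriv[OF that] \<open>L > 0\<close> by (auto intro!: derivative_eq_intros)
  have ends: "\<zeta> \<beta> = 1" "\<zeta> \<gamma> = 0" "S \<beta> = 0"
    using \<open>L > 0\<close> by (simp_all add: \<zeta>_def S_def L_def)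
  show thesis
  proof (rule that)
    show "S \<gamma> > 0"
      unfolding S_def using integral_diff_pos[OF cont_\<zeta> assms(1,2)] R_strict_mono assms(1) \<open>L > 0\<close>
      by (auto simp: \<zeta>_def)
    fix y0 c
    \<comment> \<open>The second summand is the result of integrating $q z^2$ by parts, with \<open>M\<close> added to fix the sign of \<open>Q + M\<close>.\<close>
    let ?G = "\<lambda>x. c\<^sup>2 * (R x / L\<^sup>2 + (Q x + M) * (\<zeta> x)\<^sup>2)"
    have "form \<gamma> (y0 + c * S \<gamma>) (c * \<zeta> \<gamma>) - form \<beta> (y0 + c * S \<beta>) (c * \<zeta> \<beta>) \<le> ?G \<gamma> - ?G \<beta>"
    proof (rule form_increment_le[where z' = "\<lambda>x. c * - (1 / r x / L)"
          and G' = "\<lambda>x. c\<^sup>2 * (1 / r x / L\<^sup>2 + (q x * (\<zeta> x)\<^sup>2 + (Q x + M) * (2 * \<zeta> x * - (1 / r x / L))))"])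
      fix x assume xi: "\<beta> \<le> x" "x \<le> \<gamma>"
      with assms have x: "a < x" by simp
      show "((\<lambda>x. y0 + c * S x) has_real_derivative c * \<zeta> x) (at x)"
        using S_deriv[OF x] by (auto intro!: derivative_eq_intros)
      show "((\<lambda>x. c * \<zeta> x) has_real_derivative c * - (1 / r x / L)) (at x)"
        using \<zeta>_deriv[OF x] by (rule DERIV_cmult)
      have square: "((\<lambda>x. (Q x + M) * (\<zeta> x)\<^sup>2) has_real_derivative
          q x * (\<zeta> x)\<^sup>2 + (Q x + M) * (2 * \<zeta> x * - (1 / r x / L))) (at x)"
        by (rule derivative_eq_intros Q_deriv[OF x] \<zeta>_deriv[OF x] refl)+ simp
      show "(?G has_real_derivative
          c\<^sup>2 * (1 / r x / L\<^sup>2 + (q x * (\<zeta> x)\<^sup>2 + (Q x + M) * (2 * \<zeta> x * - (1 / r x / L))))) (at x)"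
        by (intro DERIV_cmult DERIV_add DERIV_cdivide R_deriv[OF x] square)
      have "\<zeta> x \<ge> 0"
        using R_strict_mono[of x \<gamma>] x xi \<open>L > 0\<close> by (cases "x = \<gamma>") (auto simp: \<zeta>_def)
      then have "(Q x + M) * (2 * \<zeta> x * (1 / r x / L)) \<le> 0"
        using Q_le[OF xi] r_pos[of x] x \<open>L > 0\<close> by (intro mult_nonpos_nonneg) auto
      then have "1 / r x / L\<^sup>2 + q x * (\<zeta> x)\<^sup>2
          \<le> 1 / r x / L\<^sup>2 + (q x * (\<zeta> x)\<^sup>2 + (Q x + M) * (2 * \<zeta> x * - (1 / r x / L)))"
        by simp
      from mult_left_mono[OF this zero_le_power2[of c]]
      show "r x * (c * - (1 / r x / L))\<^sup>2 + q x * (c * \<zeta> x)\<^sup>2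
          \<le> c\<^sup>2 * (1 / r x / L\<^sup>2 + (q x * (\<zeta> x)\<^sup>2 + (Q x + M) * (2 * \<zeta> x * - (1 / r x / L))))"
        using r_pos[of x] x \<open>L > 0\<close> by (simp add: power_mult_distrib power2_eq_square algebra_simps)
    qed (use assms in auto)
    moreover have "?G \<gamma> - ?G \<beta> = c\<^sup>2 * (L / L\<^sup>2 - (Q \<beta> + M))"
      unfolding ends by (simp add: L_def diff_divide_distrib algebra_simps)
    moreover have "L / L\<^sup>2 = 1 / L" by (simp add: power2_eq_square)
    ultimately show "form \<gamma> (y0 + c * S \<gamma>) 0 \<le> form \<beta> y0 c + c\<^sup>2 * (1 / (R \<gamma> - R \<beta>) - M - Q \<beta>)"
      unfolding ends by (simp add: L_def[symmetric] algebra_simps)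
  qed
qed

text \<open>
  The three pieces together: a test function $z$ that starts and ends at $0$ and lowers the form by at
  least $c^2$, while $y$ moves by a prescribed amount \<open>c * I\<close> whose sign is that of $c$. Both \<open>\<gamma>\<close> and
  \<open>I\<close> are independent of the starting value of $y$ and of $c$.
\<close>

lemma form_bump:
  assumes R_top: "filterlim R at_top at_top" and Q_bot: "filterlim Q at_bot at_top" and "a < \<alpha>"
  obtains \<gamma> I where "\<alpha> < \<gamma>" "I > 0" "\<And>y0 c. form \<gamma> (y0 + c * I) 0 \<le> form \<alpha> y0 0 - c\<^sup>2"
proof -
  let ?\<beta>0 = "\<alpha> + 1"
  obtain K I1 where I1: "I1 > 0" "\<And>y0 c. form ?\<beta>0 (y0 + c * I1) c \<le> form \<alpha> y0 0 + c\<^sup>2 * K"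
    by (rule form_rise[OF \<open>a < \<alpha>\<close> less_add_one]) (rule that)
  \<comment> \<open>Large enough to pay for the rise (\<open>K\<close>), for a descent of cost at most 1, and for a surplus of 1.\<close>
  define M where "M = K - Q ?\<beta>0 + 2"
  have "\<forall>\<^sub>F x in at_top. Q x \<le> - M"
    using Q_bot by (simp add: filterlim_at_bot)
  then obtain \<beta>1 where \<beta>1: "\<And>x. x \<ge> \<beta>1 \<Longrightarrow> Q x \<le> - M"
    unfolding eventually_at_top_linorder by blast
  define \<beta> where "\<beta> = max ?\<beta>0 \<beta>1"
  have "\<forall>\<^sub>F x in at_top. R \<beta> + 1 \<le> R x"
    using R_top by (simp add: filterlim_at_top)
  then obtain \<gamma>1 where \<gamma>1: "\<And>x. x \<ge> \<gamma>1 \<Longrightarrow> R x \<ge> R \<beta> + 1"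
    unfolding eventually_at_top_linorder by blast
  define \<gamma> where "\<gamma> = max \<gamma>1 (\<beta> + 1)"
  have ord: "a < \<beta>" "\<beta> < \<gamma>" "a < ?\<beta>0" "?\<beta>0 \<le> \<beta>" "\<alpha> < \<gamma>"
    using \<open>a < \<alpha>\<close> by (auto simp: \<beta>_def \<gamma>_def)
  obtain I3 where I3: "I3 > 0"
    "\<And>y0 c. form \<gamma> (y0 + c * I3) 0 \<le> form \<beta> y0 c + c\<^sup>2 * (1 / (R \<gamma> - R \<beta>) - M - Q \<beta>)"
  proof (rule form_descent[OF ord(1,2), of M])
    show "Q x \<le> - M" if "\<beta> \<le> x" for x
      using \<beta>1[of x] that by (simp add: \<beta>_def)
  qed (rule that)
  have "1 / (R \<gamma> - R \<beta>) \<le> 1"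
    using \<gamma>1[of \<gamma>] by (simp add: \<gamma>_def)
  show thesis
  proof (rule that)
    show "\<alpha> < \<gamma>" by fact
    show "0 < I1 + (\<beta> - ?\<beta>0) + I3" using I1 I3 ord by simp
    fix y0 c
    have "form \<gamma> (y0 + c * I1 + c * (\<beta> - ?\<beta>0) + c * I3) 0
        \<le> form \<alpha> y0 0 + c\<^sup>2 * K + c\<^sup>2 * (Q \<beta> - Q ?\<beta>0) + c\<^sup>2 * (1 / (R \<gamma> - R \<beta>) - M - Q \<beta>)"
      using I3(2)[of "y0 + c * I1 + c * (\<beta> - ?\<beta>0)" c]
        form_plateau[OF ord(3,4), of "y0 + c * I1" c] I1(2)[of y0 c] by linarith
    also have "\<dots> = form \<alpha> y0 0 - c\<^sup>2 * (2 - 1 / (R \<gamma> - R \<beta>))"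
      by (simp add: M_def algebra_simps)
    also have "\<dots> \<le> form \<alpha> y0 0 - c\<^sup>2 * 1"
      using \<open>1 / (R \<gamma> - R \<beta>) \<le> 1\<close> by (intro diff_left_mono mult_left_mono) auto
    finally show "form \<gamma> (y0 + c * (I1 + (\<beta> - ?\<beta>0) + I3)) 0 \<le> form \<alpha> y0 0 - c\<^sup>2"
      by (simp add: algebra_simps)
  qed
qed

text \<open>
  Where $z = 0$ the form is $-h y^2$. A bump starting at $y = 0$ ends with a negative form, which forces
  $h > 0$ at its end. From there a second bump, scaled by $c = -1/J$ so that it carries $y$ from $1$
  to $0$, starts with the value $-h < 0$ and yet would have to end at $0$, although it only lowers the
  form.
\<close>

theorem no_global_riccati_solution:
  assumes R_top: "filterlim R at_top at_top" and Q_bot: "filterlim Q at_bot at_top"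
  shows False
proof -
  obtain \<gamma> I where 1: "a + 1 < \<gamma>" "I > 0" "\<And>y0 c. form \<gamma> (y0 + c * I) 0 \<le> form (a + 1) y0 0 - c\<^sup>2"
    by (rule form_bump[OF assms less_add_one]) (rule that)
  have "a < \<gamma>" using 1(1) by simp
  have "form \<gamma> I 0 \<le> - 1"
    using 1(3)[of 0 1] by (simp add: form_def)
  then have "h \<gamma> * I\<^sup>2 > 0" by (simp add: form_def)
  then have "h \<gamma> > 0" by (simp add: zero_less_mult_iff)
  obtain \<delta> J where 2: "\<gamma> < \<delta>" "J > 0" "\<And>y0 c. form \<delta> (y0 + c * J) 0 \<le> form \<gamma> y0 0 - c\<^sup>2"
    by (rule form_bump[OF assms \<open>a < \<gamma>\<close>]) (rule that)
  have "0 \<le> - h \<gamma> - (1 / J)\<^sup>2"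
    using 2(3)[of 1 "- 1 / J"] \<open>J > 0\<close> by (simp add: form_def power_divide)
  with \<open>h \<gamma> > 0\<close> show False by (smt (verit) zero_le_power2)
qed

end

section \<open>The determinants of the solutions vanishing at the initial point\<close>

text \<open>
  A basis of the solutions with $y(a) = y_1(a) = 0$, normalised by the remaining data $y'(a)$, $Ty(a)$.
\<close>

locale principal_solutions =
  fixes a :: real and r q p y1 z1 w1 T1 y2 z2 w2 T2 :: "real \<Rightarrow> real"
  assumes cont: "continuous_on {a..} r" "continuous_on {a..} q" "continuous_on {a..} p"
    and r_pos: "\<And>x. a \<le> x \<Longrightarrow> r x > 0" and p_pos: "\<And>x. a \<le> x \<Longrightarrow> p x > 0"
    and sys1: "quasi_system a r q p y1 z1 w1 T1"
    and sys2: "quasi_system a r q p y2 z2 w2 T2"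
    and init1: "y1 a = 0" "z1 a = 1" "w1 a = 0" "T1 a = 0"
    and init2: "y2 a = 0" "z2 a = 0" "w2 a = 0" "T2 a = 1"
begin

text \<open>
  Two-by-two minors of the matrix of the two solutions. \<open>D\<close> vanishes where some combination has
  $y = y_1 = 0$, and \<open>W\<close> where some combination has $y = y' = 0$; the other two are the numerators in
  Cramer's rule for the coefficients $k$ and $h$ of \<open>riccati_halfline\<close>.
\<close>

definition D :: "real \<Rightarrow> real" where "D x = y1 x * w2 x - y2 x * w1 x"
definition W :: "real \<Rightarrow> real" where "W x = y1 x * z2 x - y2 x * z1 x"
definition A :: "real \<Rightarrow> real" where "A x = y1 x * T2 x - y2 x * T1 x"
definition H :: "real \<Rightarrow> real" where "H x = T1 x * z2 x - T2 x * z1 x"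

text \<open>
  Lagrange's identity: the equation is formally self-adjoint, so the bilinear concomitant of two
  solutions is constant; it vanishes at \<open>a\<close> because $y$ and $y_1$ do.
\<close>

lemma lagrange_identity:
  assumes "a \<le> x"
  shows "z1 x * w2 x - z2 x * w1 x = A x"
proof -
  let ?f = "\<lambda>x. A x - (z1 x * w2 x - z2 x * w1 x)"
  have "(?f has_real_derivative 0) (at t within {a..})" if "t \<in> {a..}" for t
  proof -
    from that have t: "a \<le> t" by simp
    show ?thesis unfolding A_def
      by (rule derivative_eq_intros quasi_systemD[OF sys1 t] quasi_systemD[OF sys2 t] refl
          | simp add: algebra_simps; fail)+
  qed
  then have "\<exists>c. \<forall>x\<in>{a..}. ?f x = c"
    by (intro has_field_derivative_zero_constant) auto
  then have "?f x = ?f a" using assms by auto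
  then show ?thesis using init1 init2 by (simp add: A_def)
qed

lemma W_deriv: "a \<le> x \<Longrightarrow> (W has_real_derivative D x / r x) (at x within {a..})"
  unfolding W_def D_def
  by (rule derivative_eq_intros quasi_systemD[OF sys1] quasi_systemD[OF sys2] refl
      | assumption | simp add: algebra_simps diff_divide_distrib; fail)+

lemma A_deriv: "a \<le> x \<Longrightarrow> (A has_real_derivative - H x) (at x within {a..})"
  unfolding A_def H_def
  by (rule derivative_eq_intros quasi_systemD[OF sys1] quasi_systemD[OF sys2] refl
      | assumption | simp add: algebra_simps; fail)+

lemma D_deriv:
  assumes "a \<le> x"
  shows "(D has_real_derivative 2 * A x + q x * W x) (at x within {a..})"
proof -
  have "(D has_real_derivative A x + (z1 x * w2 x - z2 x * w1 x) + q x * W x) (at x within {a..})"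
    unfolding D_def A_def W_def
    by (rule derivative_eq_intros quasi_systemD[OF sys1 assms] quasi_systemD[OF sys2 assms] refl
        | simp add: algebra_simps; fail)+
  then show ?thesis using lagrange_identity[OF assms] by simp
qed

lemma H_deriv:
  "a \<le> x \<Longrightarrow> (H has_real_derivative p x * W x + (T1 x * w2 x - T2 x * w1 x) / r x) (at x within {a..})"
  unfolding H_def W_def
  by (rule derivative_eq_intros quasi_systemD[OF sys1] quasi_systemD[OF sys2] refl
      | assumption | simp add: algebra_simps diff_divide_distrib; fail)+

lemma initial_values: "D a = 0" "W a = 0" "A a = 0" "H a = - 1"
  using init1 init2 by (simp_all add: D_def W_def A_def H_def)

lemma continuous_D: "continuous_on {a..} D"
  using D_deriv by (rule has_real_derivative_halfline_imp_continuous)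

text \<open>
  Near \<open>a\<close> the minor \<open>A\<close> grows like $x - a$ while \<open>W\<close> is $o(x - a)$, because $W' = D/r$ vanishes at \<open>a\<close>.
  Hence $D' = 2A + qW$ is positive there. This keeps conjugate points away from \<open>a\<close>.
\<close>

lemma D_pos_near_start: obtains \<delta> where "\<delta> > 0" "\<And>x. a < x \<Longrightarrow> x < a + \<delta> \<Longrightarrow> D x > 0"
proof -
  have "((\<lambda>x. A x / (x - a)) \<longlongrightarrow> 1) (at a within {a..})"
    using A_deriv[of a] by (simp add: has_field_derivative_iff initial_values)
  moreover have "((\<lambda>x. W x / (x - a)) \<longlongrightarrow> 0) (at a within {a..})"
    using W_deriv[of a] by (simp add: has_field_derivative_iff initial_values)
  moreover have "(q \<longlongrightarrow> q a) (at a within {a..})"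
    using cont(2) by (auto simp: continuous_on_def)
  ultimately have "((\<lambda>x. 2 * (A x / (x - a)) + q x * (W x / (x - a))) \<longlongrightarrow> 2 * 1 + q a * 0) (at a within {a..})"
    by (intro tendsto_intros)
  then have "\<forall>\<^sub>F x in at a within {a..}. 0 < 2 * (A x / (x - a)) + q x * (W x / (x - a))"
    by (rule order_tendstoD) simp
  then obtain \<delta> where "\<delta> > 0"
    and *: "\<And>x. x \<in> {a..} \<Longrightarrow> x \<noteq> a \<Longrightarrow> dist x a < \<delta> \<Longrightarrow>
      0 < 2 * (A x / (x - a)) + q x * (W x / (x - a))"
    unfolding eventually_at by blast
  show thesis
  proof (rule that[OF \<open>\<delta> > 0\<close>])
    fix x assume x: "a < x" "x < a + \<delta>"
    have "D a < D x"
    proof (rule DERIV_pos_imp_increasing_open[OF \<open>a < x\<close>])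
      fix t assume t: "a < t" "t < x"
      have "0 < (2 * A t + q t * W t) / (t - a)"
        using *[of t] t x by (simp add: dist_real_def add_divide_distrib)
      then have "0 < 2 * A t + q t * W t"
        using t by (simp add: zero_less_divide_iff)
      then show "\<exists>d. (D has_real_derivative d) (at t) \<and> 0 < d"
        using D_deriv[of t] t by (intro exI conjI) (auto simp: at_within_halfline)
    qed (rule continuous_on_subset[OF continuous_D], auto)
    then show "D x > 0" by (simp add: initial_values)
  qed
qed

text \<open>
  By uniqueness, the solutions with $y(a) = y_1(a) = 0$ are exactly the combinations of the two basis
  solutions, so conjugacy of \<open>b\<close> is linear dependence of two vectors $(y(b), y_1(b))$.
\<close>

lemma systems_conjugate_points_eq: "systems_conjugate_points a r q p = {b. a < b \<and> D b = 0}"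
proof (intro equalityI subsetI)
  fix b assume "b \<in> systems_conjugate_points a r q p"
  then obtain y x where "a < b" and sol: "is_solution a r q p y" and "a \<le> x" "y x \<noteq> 0"
    and ends: "y a = 0" "quasi1 a r y a = 0" "y b = 0" "quasi1 a r y b = 0"
    unfolding systems_conjugate_points_def by blast
  note sys = is_solution_imp_quasi_system[OF sol r_pos]
  let ?c = "hderiv a y a" and ?d = "quasiT a r q y a"
  note diff = quasi_system_linear[OF sys quasi_system_linear[OF sys1 sys2, of ?c ?d], of 1 "- 1"]
  have eq: "y t = ?c * y1 t + ?d * y2 t \<and> quasi1 a r y t = ?c * w1 t + ?d * w2 t" if "a \<le> t" for t
    using quasi_system_zero[OF diff r_pos cont, of t] that ends init1 init2 by simp
  have "?c * D b = 0" "?d * D b = 0"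
  proof -
    have e: "?c * y1 b + ?d * y2 b = 0" "?c * w1 b + ?d * w2 b = 0"
      using eq[of b] ends \<open>a < b\<close> by auto
    have "?c * D b = (?c * y1 b + ?d * y2 b) * w2 b - (?c * w1 b + ?d * w2 b) * y2 b"
      by (simp add: D_def algebra_simps)
    then show "?c * D b = 0" by (simp add: e)
    have "?d * D b = (?c * w1 b + ?d * w2 b) * y1 b - (?c * y1 b + ?d * y2 b) * w1 b"
      by (simp add: D_def algebra_simps)
    then show "?d * D b = 0" by (simp add: e)
  qed
  moreover have "?c \<noteq> 0 \<or> ?d \<noteq> 0"
    using eq[OF \<open>a \<le> x\<close>] \<open>y x \<noteq> 0\<close> by auto
  ultimately show "b \<in> {b. a < b \<and> D b = 0}" using \<open>a < b\<close> by auto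
next
  fix b assume "b \<in> {b. a < b \<and> D b = 0}"
  then have "a < b" "D b = 0" by auto
  have "\<exists>c d. (c \<noteq> 0 \<or> d \<noteq> 0) \<and> c * y1 b + d * y2 b = 0 \<and> c * w1 b + d * w2 b = 0"
  proof -
    consider "y1 b \<noteq> 0 \<or> y2 b \<noteq> 0" | "w1 b \<noteq> 0 \<or> w2 b \<noteq> 0" | "y1 b = 0" "y2 b = 0" "w1 b = 0" "w2 b = 0"
      by blast
    then show ?thesis
    proof cases
      \<comment> \<open>Each nonzero row of the singular matrix supplies a kernel vector.\<close>
      case 1
      then show ?thesis using \<open>D b = 0\<close>
        by (intro exI[of _ "y2 b"] exI[of _ "- y1 b"]) (auto simp: D_def algebra_simps)
    next
      case 2
      then show ?thesis using \<open>D b = 0\<close>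
        by (intro exI[of _ "w2 b"] exI[of _ "- w1 b"]) (auto simp: D_def algebra_simps)
    next
      case 3
      then show ?thesis by (intro exI[of _ 1] exI[of _ 0]) simp
    qed
  qed
  then obtain c d where nz: "c \<noteq> 0 \<or> d \<noteq> 0"
    and b: "c * y1 b + d * y2 b = 0" "c * w1 b + d * w2 b = 0" by blast
  note sys = quasi_system_linear[OF sys1 sys2, of c d]
  note sol = quasi_system_imp_is_solution[OF sys r_pos cont]
  have "\<exists>x\<ge>a. c * y1 x + d * y2 x \<noteq> 0"
    using quasi_system_trivial[OF sys r_pos] nz init1 init2 by auto
  then show "b \<in> systems_conjugate_points a r q p"
    unfolding systems_conjugate_points_def
    using sol(1) sol(2)[of a] sol(2)[of b] b \<open>a < b\<close> init1 init2
    by (auto intro!: exI[of _ "\<lambda>x. c * y1 x + d * y2 x"])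
qed

text \<open>
  The conjugate points form a closed set away from \<open>a\<close>, so their infimum is attained.
\<close>

lemma first_conjugate_point_exists:
  assumes "a < b" "D b = 0"
  shows "systems_conjugate a r q p"
proof -
  obtain \<delta> where \<delta>: "\<delta> > 0" "\<And>x. a < x \<Longrightarrow> x < a + \<delta> \<Longrightarrow> D x > 0"
    using D_pos_near_start by blast
  let ?S = "{x \<in> {a + \<delta>..}. D x = 0}"
  have S: "systems_conjugate_points a r q p = ?S"
    unfolding systems_conjugate_points_eq using \<delta> by (force simp: not_less[symmetric])
  have "closed ?S"
    using \<open>\<delta> > 0\<close> by (intro continuous_closed_preimage_constant continuous_on_subset[OF continuous_D]) auto
  moreover have "bdd_below ?S" by (rule bdd_belowI[of _ "a + \<delta>"]) auto
  moreover have "?S \<noteq> {}" using assms S systems_conjugate_points_eq by blast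
  ultimately have "Inf ?S \<in> ?S" and "\<forall>c\<in>?S. Inf ?S \<le> c"
    using closed_contains_Inf[of ?S] cInf_lower[of _ ?S] by blast+
  then show ?thesis
    unfolding systems_conjugate_def is_first_systems_conjugate_point_def S by blast
qed

text \<open>
  If \<open>D\<close> has no zero it stays positive, and then $W' = D/r$ makes \<open>W\<close> positive too. So the plane spanned
  by the two solutions has $(y, y')$ as coordinates on all of $(a,\<infinity>)$. The equation for \<open>h\<close> also needs
  the quadratic relation between the minors of a matrix with two rows.
\<close>

lemma minors_satisfy_riccati:
  assumes D_nz: "\<And>x. a < x \<Longrightarrow> D x \<noteq> 0"
  shows "riccati_halfline a r q p (\<lambda>x. D x / W x) (\<lambda>x. A x / W x) (\<lambda>x. H x / W x)"
proof -
  obtain \<delta> where \<delta>: "\<delta> > 0" "\<And>x. a < x \<Longrightarrow> x < a + \<delta> \<Longrightarrow> D x > 0"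
    using D_pos_near_start by blast
  have D_pos: "D x > 0" if "a < x" for x
  proof (rule ccontr)
    assume "\<not> D x > 0"
    define s where "s = min x (a + \<delta> / 2)"
    have s: "a < s" "s \<le> x" "D s > 0"
      using \<delta> that by (auto simp: s_def)
    have "\<exists>t\<ge>s. t \<le> x \<and> D t = 0"
      using s \<open>\<not> D x > 0\<close> by (intro IVT2' continuous_on_subset[OF continuous_D]) auto
    with D_nz s(1) show False by force
  qed
  have W_pos: "W x > 0" if "a < x" for x
  proof -
    have "W a < W x"
    proof (rule DERIV_pos_imp_increasing_open[OF that])
      show "\<exists>d. (W has_real_derivative d) (at t) \<and> 0 < d" if "a < t" for t
        using W_deriv[of t] D_pos[OF that] r_pos[of t] that
        by (intro exI[of _ "D t / r t"]) (auto simp: at_within_halfline)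
      have "continuous_on {a..} W"
        using W_deriv by (rule has_real_derivative_halfline_imp_continuous)
      then show "continuous_on {a..x} W" by (rule continuous_on_subset) auto
    qed
    then show ?thesis by (simp add: initial_values)
  qed
  have quotient: "((\<lambda>x. f x / W x) has_real_derivative (f' * W x - f x * (D x / r x)) / (W x)\<^sup>2) (at x)"
    if "a < x" "(f has_real_derivative f') (at x within {a..})" for f f' x
    using DERIV_divide[OF that(2) W_deriv] W_pos[OF that(1)] that(1)
    by (simp add: at_within_halfline power2_eq_square)
  show ?thesis
  proof
    fix x assume x: "a < x"
    then have r: "r x \<noteq> 0" and W: "W x \<noteq> 0" and "a \<le> x"
      using r_pos[of x] W_pos[of x] by auto
    show "((\<lambda>x. D x / W x) has_real_derivative q x + 2 * (A x / W x) - (D x / W x)\<^sup>2 / r x) (at x)"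
      using quotient[OF x D_deriv[OF \<open>a \<le> x\<close>]] r W
      by (rule_tac DERIV_cong) (assumption, simp add: field_simps power2_eq_square)
    show "((\<lambda>x. A x / W x) has_real_derivative - (H x / W x) - A x / W x * (D x / W x) / r x) (at x)"
      using quotient[OF x A_deriv[OF \<open>a \<le> x\<close>]] r W
      by (rule_tac DERIV_cong) (assumption, simp add: field_simps power2_eq_square)
    have pluecker: "(T1 x * w2 x - T2 x * w1 x) * W x - H x * D x = (A x)\<^sup>2"
    proof -
      have "(T1 x * w2 x - T2 x * w1 x) * W x - H x * D x = A x * (z1 x * w2 x - z2 x * w1 x)"
        unfolding W_def H_def D_def A_def by (simp add: algebra_simps)
      then show ?thesis using lagrange_identity[OF \<open>a \<le> x\<close>] by (simp add: power2_eq_square)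
    qed
    have "((p x * W x + (T1 x * w2 x - T2 x * w1 x) / r x) * W x - H x * (D x / r x)) / (W x)\<^sup>2
        = p x + ((T1 x * w2 x - T2 x * w1 x) * W x - H x * D x) / (r x * (W x)\<^sup>2)"
      using r W by (simp add: field_simps power2_eq_square)
    also have "\<dots> = p x + (A x / W x)\<^sup>2 / r x"
      unfolding pluecker by (simp add: power_divide)
    finally show "((\<lambda>x. H x / W x) has_real_derivative p x + (A x / W x)\<^sup>2 / r x) (at x)"
      using quotient[OF x H_deriv[OF \<open>a \<le> x\<close>]] by simp
  qed (use cont r_pos p_pos in auto)
qed

end

section \<open>Existence of the first systems-conjugate point\<close>

theorem theorem5p2:
  fixes a :: real and r q p :: "real \<Rightarrow> real"
  assumes "a \<ge> 0"
    and "continuous_on {a..} r" and "continuous_on {a..} q" and "continuous_on {a..} p"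
    and "\<And>x. x \<ge> a \<Longrightarrow> r x > 0" and "\<And>x. x \<ge> a \<Longrightarrow> p x > 0"
    and "filterlim (\<lambda>x. integral {a..x} (\<lambda>t. 1 / r t)) at_top at_top"
    and "filterlim (\<lambda>x. integral {a..x} q) at_bot at_top"
  shows "systems_conjugate a r q p"
proof -
  obtain y1 z1 w1 T1 where 1: "quasi_system a r q p y1 z1 w1 T1"
    "y1 a = 0" "z1 a = 1" "w1 a = 0" "T1 a = 0"
    using quasi_system_exists[OF assms(5,2,3,4)] by metis
  obtain y2 z2 w2 T2 where 2: "quasi_system a r q p y2 z2 w2 T2"
    "y2 a = 0" "z2 a = 0" "w2 a = 0" "T2 a = 1"
    using quasi_system_exists[OF assms(5,2,3,4)] by metis
  interpret principal_solutions a r q p y1 z1 w1 T1 y2 z2 w2 T2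
    using assms 1 2 by unfold_locales auto
  show ?thesis
  proof (rule ccontr)
    assume "\<not> systems_conjugate a r q p"
    then have "\<And>x. a < x \<Longrightarrow> D x \<noteq> 0"
      using first_conjugate_point_exists by blast
    then interpret riccati_halfline a r q p "\<lambda>x. D x / W x" "\<lambda>x. A x / W x" "\<lambda>x. H x / W x"
      by (rule minors_satisfy_riccati)
    show False
      by (rule no_global_riccati_solution) (use assms(7,8) in \<open>simp_all add: R_def[abs_def] Q_def[abs_def]\<close>)
  qed
qed

end
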